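(* Let $(n,d,m,k,\mathbf{A})$ be an element of an RSVD admissible sequence, let $\sigma_1\ge\dots\ge\sigma_m>0$ be the non-zero singular values of $\mathbf{A}$, and let $\tilde{\Theta}$ be the unique positive solution of $$\sum_{j=1}^{m} \frac{\sigma_j^2}{\tilde{\Theta}+k\sigma_j^2} = 1 .$$ Let $r<k$ be arbitrary and set $$C=C(k,r,m)=\frac{(m-k)k}{(m-r)(k-r)} .$$ Then $$\sum_{j=k+1}^{m}\sigma_j^2 \;\le\; \tilde{\Theta} \;\le\; C\sum_{j=r+1}^{m}\sigma_j^2 .$$
   Context: An RSVD admissible sequence is any sequence $\{(n_i,d_i,m_i,k_i,\mathbf{A}^{(i)})\}_{i\in\mathbb{N}}$ where $\mathbf{A}^{(i)}\in\mathbb{R}^{n_i\times d_i}$ and $k_i\le \operatorname{rank}(\mathbf{A}^{(i)})=m_i$ are such that $k_i\to\infty$; the index $i$ is dropped, so the claim concerns a generic element of such a sequence. Here $r$ is a non-negative integer (the "target rank"). *)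

theory Defs
  imports
    Complex_Main
    "HOL-Computational_Algebra.Polynomial"
    "Jordan_Normal_Form.Char_Poly"
    "Jordan_Normal_Form.DL_Rank"
begin

abbreviation mat_rank :: "real mat \<Rightarrow> nat" where
  "mat_rank A \<equiv> vec_space.rank (dim_row A) A"

text \<open>The singular values of \<open>A\<close> are the square roots of the eigenvalues of \<open>A\<^sup>T A\<close>, repeated
  according to multiplicity. As \<open>A\<^sup>T A\<close> is symmetric and positive semidefinite, all complex roots
  of its characteristic polynomial are real and non-negative, and the algebraic multiplicity used
  here agrees with the geometric one.\<close>

definition nonzero_singular_values :: "real mat \<Rightarrow> real multiset" where
  "nonzero_singular_values A =
     image_mset sqrt (filter_mset (\<lambda>x. x \<noteq> 0) (proots (char_poly (transpose_mat A * A))))"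

definition rsvd_admissible :: "(nat \<Rightarrow> nat \<times> nat \<times> nat \<times> nat \<times> real mat) \<Rightarrow> bool" where
  "rsvd_admissible s \<longleftrightarrow>
     (\<forall>i n d m k A. s i = (n, d, m, k, A) \<longrightarrow>
        A \<in> carrier_mat n d \<and> mat_rank A = m \<and> k \<le> m) \<and>
     filterlim (\<lambda>i. case s i of (n, d, m, k, A) \<Rightarrow> k) at_top sequentially"

text \<open>The equation that determines \<open>\<Theta>\<close> has exactly one positive solution if \<open>k < m\<close>. For \<open>k = m\<close>
  the left-hand side equals 1 at \<open>\<Theta> = 0\<close> and is strictly decreasing, so there is none.\<close>

lemma ex1_positive_theta:
  fixes \<sigma> :: "nat \<Rightarrow> real"
  assumes pos: "\<forall>j\<in>{1..m}. \<sigma> j > 0" and k: "0 < k" "k < m"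
  shows "\<exists>!\<Theta>. \<Theta> > 0 \<and> (\<Sum>j = 1..m. (\<sigma> j)\<^sup>2 / (\<Theta> + real k * (\<sigma> j)\<^sup>2)) = 1"
proof -
  define f where "f = (\<lambda>T. \<Sum>j = 1..m. (\<sigma> j)\<^sup>2 / (T + real k * (\<sigma> j)\<^sup>2))"
  define B where "B = (\<Sum>j = 1..m. (\<sigma> j)\<^sup>2)"
  have sq: "(\<sigma> j)\<^sup>2 > 0" if "j \<in> {1..m}" for j
    using pos that by (metis less_irrefl zero_less_power2)
  have den: "T + real k * (\<sigma> j)\<^sup>2 > 0" if "j \<in> {1..m}" "T \<ge> 0" for j T
    using sq[OF that(1)] that(2) k by (simp add: add_nonneg_pos)
  have ne: "{1..m} \<noteq> {}" using k by auto
  have B: "B > 0" unfolding B_def by (intro sum_pos) (use sq ne in auto)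
  have f0: "f 0 = real m / real k"
  proof -
    have "f 0 = (\<Sum>j = 1..m. 1 / real k)"
      unfolding f_def by (intro sum.cong refl) (use sq k in \<open>force simp: field_simps\<close>)
    then show ?thesis by simp
  qed
  have anti: "f b < f a" if "0 \<le> a" "a < b" for a b
    unfolding f_def
  proof (rule sum_strict_mono)
    show "(\<sigma> j)\<^sup>2 / (b + real k * (\<sigma> j)\<^sup>2) < (\<sigma> j)\<^sup>2 / (a + real k * (\<sigma> j)\<^sup>2)"
      if j: "j \<in> {1..m}" for j
      using den[OF j \<open>0 \<le> a\<close>] sq[OF j] \<open>a < b\<close> by (intro divide_strict_left_mono) auto
  qed (use ne in auto)
  have fB: "f B \<le> 1"
  proof -
    have "f B \<le> (\<Sum>j = 1..m. (\<sigma> j)\<^sup>2 / B)"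
      unfolding f_def by (intro sum_mono divide_left_mono) (use B in \<open>auto simp: add_pos_nonneg\<close>)
    also have "\<dots> = 1" using B by (simp add: B_def flip: sum_divide_distrib)
    finally show ?thesis .
  qed
  have "continuous_on {0..B} f"
    unfolding f_def by (intro continuous_intros) (use den in force)
  moreover have "f 0 > 1" using f0 k by simp
  ultimately obtain T where T: "0 \<le> T" "f T = 1"
    using IVT2'[of f B 1 0] fB B by auto
  have T0: "T > 0" using T \<open>f 0 > 1\<close> by (cases "T = 0") auto
  have uniq: "S = T" if "S > 0" "f S = 1" for S
    using anti[of S T] anti[of T S] that T T0 by (cases S T rule: linorder_cases) auto
  show ?thesis
    using T T0 uniq unfolding f_def by blast
qed

end

theory Submission
  imports Defs "HOL-Analysis.Convex"
begin

text \<open>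
  For the positive decreasing sequence \<open>a\<^sub>j = \<sigma>\<^sub>j\<^sup>2\<close>, the equation for \<open>\<Theta>\<close> reads
  \<open>\<Sum>\<^sub>j x\<^sub>j = 1\<close> with \<open>x\<^sub>j = a\<^sub>j / (\<Theta> + k a\<^sub>j)\<close>. The bounds follow because the map \<open>a \<mapsto> a / (\<Theta> + k a)\<close> is increasing,
  concave and bounded by \<open>1 / k\<close>.

  Lower bound: by monotonicity the first \<open>k\<close> of the \<open>x\<^sub>j\<close> are at least \<open>a\<^sub>k / (\<Theta> + k a\<^sub>k)\<close>, and each
  later one is at least \<open>a\<^sub>j / (\<Theta> + k a\<^sub>k)\<close> because its denominator is the smaller one. So \<open>k a\<^sub>k\<close> plus the tail \<open>\<Sum>\<^bsub>j>k\<^esub> a\<^sub>j\<close> is at most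
  \<open>\<Theta> + k a\<^sub>k\<close>, and \<open>k a\<^sub>k\<close> cancels (\<open>tail_sum_le_theta\<close>).

  Upper bound: by boundedness the first \<open>r\<close> of the \<open>x\<^sub>j\<close> contribute at most \<open>r / k\<close>, so the remaining
  \<open>m - r\<close> contribute at least \<open>(k - r) / k\<close>. Concavity bounds that contribution in terms of the mean
  of the remaining \<open>a\<^sub>j\<close>; it takes the form of the inequality between arithmetic and harmonic means
  for the numbers \<open>1 + k a\<^sub>j / \<Theta>\<close>, because \<open>1 - k x\<^sub>j\<close> is the reciprocal of that number
  (\<open>theta_le_tail_sum\<close>).
\<close>

text \<open>The inequality between harmonic and arithmetic means, cleared of denominators: Cauchy--Schwarz
  for \<open>sqrt u\<^sub>j\<close> and \<open>1 / sqrt u\<^sub>j\<close>.\<close>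

lemma card_squared_le_sum_times_sum_inverse:
  fixes u :: "'a \<Rightarrow> real"
  assumes "\<And>j. j \<in> I \<Longrightarrow> u j > 0"
  shows "(real (card I))\<^sup>2 \<le> (\<Sum>j\<in>I. u j) * (\<Sum>j\<in>I. 1 / u j)"
proof -
  have "real (card I) = (\<Sum>j\<in>I. sqrt (u j) * sqrt (1 / u j))"
    using assms by (simp add: less_imp_neq[symmetric] flip: real_sqrt_mult)
  also have "\<dots>\<^sup>2 \<le> (\<Sum>j\<in>I. (sqrt (u j))\<^sup>2) * (\<Sum>j\<in>I. (sqrt (1 / u j))\<^sup>2)"
    by (rule Cauchy_Schwarz_ineq_sum)
  also have "\<dots> = (\<Sum>j\<in>I. u j) * (\<Sum>j\<in>I. 1 / u j)"
    using assms by (auto intro!: arg_cong2[of _ _ _ _ "(*)"] sum.cong simp: less_imp_le)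
  finally show ?thesis .
qed

text \<open>All summands are compared with fractions over the common denominator \<open>\<Theta> + k a\<^sub>k\<close>: the
  first \<open>k\<close> by monotonicity of \<open>a \<mapsto> a / (\<Theta> + k a)\<close>, the later ones by keeping the numerator and
  enlarging the denominator. The head then contributes exactly the \<open>k a\<^sub>k\<close> that cancels.\<close>

lemma tail_sum_le_theta:
  fixes a :: "nat \<Rightarrow> real"
  assumes pos: "\<And>j. j \<in> {1..m} \<Longrightarrow> a j > 0"
    and anti: "\<And>j l. 1 \<le> j \<Longrightarrow> j \<le> l \<Longrightarrow> l \<le> m \<Longrightarrow> a l \<le> a j"
    and k: "0 < k" "k \<le> m" and \<Theta>: "\<Theta> > 0"
    and eq: "(\<Sum>j = 1..m. a j / (\<Theta> + real k * a j)) = 1"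
  shows "(\<Sum>j = k+1..m. a j) \<le> \<Theta>"
proof -
  define D where "D = \<Theta> + real k * a k"
  have den: "\<Theta> + real k * a j > 0" if "j \<in> {1..m}" for j
    using pos[OF that] \<Theta> k by (simp add: add_pos_pos)
  have D: "D > 0" unfolding D_def using den k by simp
  have head: "a k / D \<le> a j / (\<Theta> + real k * a j)" if "j \<in> {1..k}" for j
  proof -
    have "\<Theta> * a k \<le> \<Theta> * a j" using anti[of j k] that k \<Theta> by simp
    then show ?thesis
      using D den[of j] that k unfolding D_def by (simp add: divide_simps algebra_simps)
  qed
  have tail: "a j / D \<le> a j / (\<Theta> + real k * a j)" if "j \<in> {k+1..m}" for j
    using that k anti[of k j] pos[of j] den[of j] D
    unfolding D_def by (intro divide_left_mono) auto
  have "(real k * a k + (\<Sum>j = k+1..m. a j)) / D = (\<Sum>j = 1..k. a k / D) + (\<Sum>j = k+1..m. a j / D)"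
    by (simp add: add_divide_distrib sum_divide_distrib)
  also have "\<dots> \<le> (\<Sum>j = 1..k. a j / (\<Theta> + real k * a j)) + (\<Sum>j = k+1..m. a j / (\<Theta> + real k * a j))"
    by (intro add_mono sum_mono head tail)
  also have "\<dots> = 1"
    using eq k sum.ub_add_nat[of 1 k "\<lambda>j. a j / (\<Theta> + real k * a j)" "m - k"] by simp
  finally show ?thesis using D by (simp add: D_def)
qed

text \<open>With \<open>u\<^sub>j = 1 + k a\<^sub>j / \<Theta>\<close>, the \<open>j\<close>-th summand of the equation is \<open>(1 - 1 / u\<^sub>j) / k\<close>, so the
  equation says that the sum of all \<open>1 / u\<^sub>j\<close> is \<open>m - k\<close>. The part of that sum with \<open>j > r\<close> is no
  larger, which expresses that the discarded summands are at most \<open>1 / k\<close> each. The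
  arithmetic-harmonic mean inequality turns this into a lower bound for \<open>\<Sum>\<^bsub>j>r\<^esub> u\<^sub>j\<close>, that is, for \<open>\<Sum>\<^bsub>j>r\<^esub> a\<^sub>j\<close>.\<close>

lemma theta_le_tail_sum:
  fixes a :: "nat \<Rightarrow> real"
  assumes pos: "\<And>j. j \<in> {1..m} \<Longrightarrow> a j > 0" and r: "r < k" "k \<le> m" and \<Theta>: "\<Theta> > 0"
    and eq: "(\<Sum>j = 1..m. a j / (\<Theta> + real k * a j)) = 1"
  shows "\<Theta> \<le> ((real m - real k) * real k) / ((real m - real r) * (real k - real r))
               * (\<Sum>j = r+1..m. a j)"
proof -
  define u where "u = (\<lambda>j. 1 + real k * a j / \<Theta>)"
  define S where "S = (\<Sum>j = r+1..m. a j)"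
  define N where "N = real m - real r"
  have u: "u j > 0" if "j \<in> {1..m}" for j
    unfolding u_def using pos[OF that] \<Theta> by (simp add: add_pos_nonneg less_imp_le)
  have "1 / u j = 1 - real k * (a j / (\<Theta> + real k * a j))" if "j \<in> {1..m}" for j
  proof -
    have "\<Theta> + real k * a j > 0" using pos[OF that] \<Theta> by (simp add: add_pos_nonneg less_imp_le)
    then show ?thesis using \<Theta> u[OF that] unfolding u_def by (simp add: field_simps)
  qed
  then have "(\<Sum>j = 1..m. 1 / u j) = (\<Sum>j = 1..m. 1 - real k * (a j / (\<Theta> + real k * a j)))"
    by (rule sum.cong[OF refl])
  also have "\<dots> = real m - real k"
    unfolding sum_subtractf sum_distrib_left[symmetric] eq by simp
  finally have "(\<Sum>j = 1..m. 1 / u j) = real m - real k" .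
  moreover have "(\<Sum>j = r+1..m. 1 / u j) \<le> (\<Sum>j = 1..m. 1 / u j)"
    using u by (intro sum_mono2) (auto simp: less_imp_le)
  ultimately have inv: "(\<Sum>j = r+1..m. 1 / u j) \<le> real m - real k" by simp
  have card: "real (card {r+1..m}) = N"
    using r by (simp add: N_def of_nat_diff)
  have sum_u: "(\<Sum>j = r+1..m. u j) = N + real k * S / \<Theta>"
    using card by (simp add: u_def S_def sum.distrib sum_distrib_left sum_divide_distrib)
  have "0 \<le> (\<Sum>j = r+1..m. u j)"
    using u by (intro sum_nonneg) (auto simp: less_imp_le)
  then have "N\<^sup>2 \<le> (N + real k * S / \<Theta>) * (real m - real k)"
    using card_squared_le_sum_times_sum_inverse[of "{r+1..m}" u] u card
      mult_left_mono[OF inv, of "\<Sum>j = r+1..m. u j"]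
    unfolding sum_u by auto
  then have "\<Theta> * (N * (N - (real m - real k))) \<le> (real m - real k) * real k * S"
    using \<Theta> by (simp add: field_simps power2_eq_square)
  moreover have "N - (real m - real k) = real k - real r" by (simp add: N_def)
  ultimately have "\<Theta> * (N * (real k - real r)) \<le> (real m - real k) * real k * S" by metis
  moreover have "N * (real k - real r) > 0" using r by (simp add: N_def)
  ultimately have "\<Theta> \<le> (real m - real k) * real k * S / (N * (real k - real r))"
    by (simp only: pos_le_divide_eq)
  then show ?thesis
    unfolding N_def S_def by simp
qed

theorem proposition1:
  fixes s :: "nat \<Rightarrow> nat \<times> nat \<times> nat \<times> nat \<times> real mat"
    and i n d m k r :: nat
    and A :: "real mat"
    and \<sigma> :: "nat \<Rightarrow> real"
    and \<Theta> C :: real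
  assumes "rsvd_admissible s"
    and "s i = (n, d, m, k, A)"
    and "image_mset \<sigma> (mset_set {1..m}) = nonzero_singular_values A"
    and "\<forall>j\<in>{1..m}. \<sigma> j > 0"
    and "\<forall>j\<in>{1..m}. \<forall>l\<in>{1..m}. j \<le> l \<longrightarrow> \<sigma> l \<le> \<sigma> j"
    and "\<Theta> > 0"
    and "(\<Sum>j = 1..m. (\<sigma> j)\<^sup>2 / (\<Theta> + real k * (\<sigma> j)\<^sup>2)) = 1"
    and "r < k"
    and "C = ((real m - real k) * real k) / ((real m - real r) * (real k - real r))"
  shows "(\<Sum>j = k+1..m. (\<sigma> j)\<^sup>2) \<le> \<Theta> \<and> \<Theta> \<le> C * (\<Sum>j = r+1..m. (\<sigma> j)\<^sup>2)"
proof -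
  have k: "0 < k" "k \<le> m"
    using assms(1,2,8) by (auto simp: rsvd_admissible_def)
  have pos: "(\<sigma> j)\<^sup>2 > 0" if "j \<in> {1..m}" for j
    using assms(4) that by (metis less_irrefl zero_less_power2)
  have anti: "(\<sigma> l)\<^sup>2 \<le> (\<sigma> j)\<^sup>2" if "1 \<le> j" "j \<le> l" "l \<le> m" for j l
    using assms(4,5) that by (intro power_mono) (auto simp: less_imp_le)
  show ?thesis
    using tail_sum_le_theta[OF pos anti k assms(6,7)]
      theta_le_tail_sum[OF pos assms(8) k(2) assms(6,7)] assms(9) by simp
qed

end
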